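(* If $X\in\mathcal M_{mn}$, then: (i) $R_X^J=R_X\cap P_1$ if $X\in P_1$, and $R_X^J=\{X\}$ if $X\in\mathcal M_{mn}\setminus P_1$; (ii) $L_X^J=L_X\cap P_2$ if $X\in P_2$, and $L_X^J=\{X\}$ if $X\in\mathcal M_{mn}\setminus P_2$; (iii) $H_X^J=H_X$ if $X\in P$, and $H_X^J=\{X\}$ if $X\in\mathcal M_{mn}\setminus P$; (iv) $D_X^J=D_X\cap P$ if $X\in P$; $D_X^J=L_X^J$ if $X\in P_2\setminus P_1$; $D_X^J=R_X^J$ if $X\in P_1\setminus P_2$; and $D_X^J=\{X\}$ if $X\in\mathcal M_{mn}\setminus(P_1\cup P_2)$. In particular, $R_X^J=L_X^J=H_X^J=D_X^J=\{X\}$ if $\operatorname{rank}(X)>r$. If $X\in\mathcal M_{mn}\setminus P$, then $H_X^J=\{X\}$ is a non-group $\mathcal H^J$-class of $\mathcal M_{mn}^J$.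
   Context: Let $\mathbb F$ be a field, $m,n\geq1$ integers, and $0\leq r\leq\min(m,n)$. $\mathcal M_{kl}$ denotes the set of all $k\times l$ matrices over $\mathbb F$. Let $J=\begin{bmatrix}I_r&O\\O&O\end{bmatrix}\in\mathcal M_{nm}$ (an $n\times m$ matrix), and let $\mathcal M_{mn}^J$ be the semigroup with underlying set $\mathcal M_{mn}$ and operation $X\star Y=XJY$. For $X\in\mathcal M_{mn}$ put $R_X=\{Y\in\mathcal M_{mn}:\operatorname{Col}(Y)=\operatorname{Col}(X)\}$, $L_X=\{Y\in\mathcal M_{mn}:\operatorname{Row}(Y)=\operatorname{Row}(X)\}$, $H_X=R_X\cap L_X$, and $D_X=\{Y\in\mathcal M_{mn}:\operatorname{rank}(Y)=\operatorname{rank}(X)\}$, where $\operatorname{Row}$ and $\operatorname{Col}$ denote row and column space. (These are the classes in $\mathcal M_{mn}$ of Green's relations on the category of all finite-dimensional matrices over $\mathbb F$.) $\mathcal R^J,\mathcal L^J,\mathcal H^J,\mathcal D^J$ denote the usual Green's relations of the semigroup $\mathcal M_{mn}^J$ (e.g. $X\mathrel{\mathcal R^J}Y$ iff $X=Y$, or $X=Y\star U$ and $Y=X\star V$ for some $U,V\in\mathcal M_{mn}$), and $R_X^J,L_X^J,H_X^J,D_X^J$ are the corresponding classes of $X$. $P_1=\{X\in\mathcal M_{mn}:\operatorname{Col}(XJ)=\operatorname{Col}(X)\}$, $P_2=\{X\in\mathcal M_{mn}:\operatorname{Row}(JX)=\operatorname{Row}(X)\}$, $P=P_1\cap P_2$.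 *)

theory Defs
  imports "Jordan_Normal_Form.DL_Rank" "HOL-Algebra.Group"
begin

section \<open>Green's relations of a semigroup\<close>

text \<open>
  A semigroup is given by a carrier \<open>S\<close> and an operation \<open>f\<close> on the surrounding type.  The
  disjunct \<open>x = y\<close> in the first two definitions accounts for the identity element adjoined in
  \<open>S\<^sup>1\<close>.
\<close>

definition green_R :: "'s set \<Rightarrow> ('s \<Rightarrow> 's \<Rightarrow> 's) \<Rightarrow> 's rel" where
  "green_R S f = {(x, y). x \<in> S \<and> y \<in> S \<and>
     (x = y \<or> (\<exists>u\<in>S. \<exists>v\<in>S. x = f y u \<and> y = f x v))}"

definition green_L :: "'s set \<Rightarrow> ('s \<Rightarrow> 's \<Rightarrow> 's) \<Rightarrow> 's rel" where
  "green_L S f = {(x, y). x \<in> S \<and> y \<in> S \<and>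
     (x = y \<or> (\<exists>u\<in>S. \<exists>v\<in>S. x = f u y \<and> y = f v x))}"

definition green_H :: "'s set \<Rightarrow> ('s \<Rightarrow> 's \<Rightarrow> 's) \<Rightarrow> 's rel" where
  "green_H S f = green_R S f \<inter> green_L S f"

text \<open>
  The two relations composed here commute (\<open>green_D_commute\<close> below), so that this is also their
  join as equivalence relations.
\<close>

definition green_D :: "'s set \<Rightarrow> ('s \<Rightarrow> 's \<Rightarrow> 's) \<Rightarrow> 's rel" where
  "green_D S f = green_R S f O green_L S f"

lemma green_D_commute:
  assumes closed: "\<And>x y. x \<in> S \<Longrightarrow> y \<in> S \<Longrightarrow> f x y \<in> S"
    and assoc: "\<And>x y z. x \<in> S \<Longrightarrow> y \<in> S \<Longrightarrow> z \<in> S \<Longrightarrow> f (f x y) z = f x (f y z)"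
  shows "green_R S f O green_L S f = green_L S f O green_R S f"
proof (intro equalityI subrelI)
  fix x z
  assume "(x, z) \<in> green_R S f O green_L S f"
  then obtain y where R: "(x, y) \<in> green_R S f" and L: "(y, z) \<in> green_L S f" by blast
  have S: "x \<in> S" "y \<in> S" "z \<in> S" using R L unfolding green_R_def green_L_def by blast+
  consider "x = y" | "y = z"
    | u v s t where "u \<in> S" "v \<in> S" "x = f y u" "y = f x v" "s \<in> S" "t \<in> S" "y = f s z" "z = f t y"
    using R L unfolding green_R_def green_L_def by blast
  then show "(x, z) \<in> green_L S f O green_R S f"
  proof cases
    case 1
    then have "(x, z) \<in> green_L S f" "(z, z) \<in> green_R S f" using L S by (auto simp: green_R_def)
    then show ?thesis by blast
  next
    case 2
    then have "(x, x) \<in> green_L S f" "(x, z) \<in> green_R S f" using R S by (auto simp: green_L_def)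
    then show ?thesis by blast
  next
    case 3
    let ?w = "f z u"
    have w: "?w \<in> S" using 3 S closed by blast
    have 1: "x = f s ?w" using 3(3,7) assoc[OF 3(5) S(3) 3(1)] by simp
    have 2: "?w = f t x" using 3(3,8) assoc[OF 3(6) S(2) 3(1)] by simp
    have 4: "z = f ?w v" using 2 3(4,8) assoc[OF 3(6) S(1) 3(2)] by simp
    have "(x, ?w) \<in> green_L S f" unfolding green_L_def using S(1) w 1 2 3(5,6) by blast
    moreover have "(?w, z) \<in> green_R S f" unfolding green_R_def using S(3) w 4 3(1,2) by blast
    ultimately show ?thesis by blast
  qed
next
  fix x z
  assume "(x, z) \<in> green_L S f O green_R S f"
  then obtain y where L: "(x, y) \<in> green_L S f" and R: "(y, z) \<in> green_R S f" by blast
  have S: "x \<in> S" "y \<in> S" "z \<in> S" using R L unfolding green_R_def green_L_def by blast+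
  consider "x = y" | "y = z"
    | u v s t where "u \<in> S" "v \<in> S" "y = f z u" "z = f y v" "s \<in> S" "t \<in> S" "x = f s y" "y = f t x"
    using R L unfolding green_R_def green_L_def by blast
  then show "(x, z) \<in> green_R S f O green_L S f"
  proof cases
    case 1
    then have "(x, z) \<in> green_R S f" "(z, z) \<in> green_L S f" using R S by (auto simp: green_L_def)
    then show ?thesis by blast
  next
    case 2
    then have "(x, x) \<in> green_R S f" "(x, z) \<in> green_L S f" using L S by (auto simp: green_R_def)
    then show ?thesis by blast
  next
    case 3
    let ?w = "f s z"
    have w: "?w \<in> S" using 3 S closed by blast
    have 1: "x = f ?w u" using 3(3,7) assoc[OF 3(5) S(3) 3(1)] by simp
    have 2: "?w = f x v" using 3(4,7) assoc[OF 3(5) S(2) 3(2)] by simp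
    have 4: "z = f t ?w" using 2 3(4,8) assoc[OF 3(6) S(1) 3(2)] by simp
    have "(x, ?w) \<in> green_R S f" unfolding green_R_def using S(1) w 1 2 3(1,2) by blast
    moreover have "(?w, z) \<in> green_L S f" unfolding green_L_def using S(3) w 4 3(5,6) by blast
    ultimately show ?thesis by blast
  qed
qed

definition is_group_under :: "'s set \<Rightarrow> ('s \<Rightarrow> 's \<Rightarrow> 's) \<Rightarrow> bool" where
  "is_group_under H f \<longleftrightarrow> (\<exists>e. group \<lparr>carrier = H, mult = f, one = e\<rparr>)"


section \<open>Row space, column space and rank\<close>

text \<open>
  The library notions take the dimension of the ambient vector space as an explicit parameter:
  the number of columns for the row space, the number of rows for the column space and the rank.
\<close>

definition Row :: "'a::field mat \<Rightarrow> 'a vec set" where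
  "Row A = vec_space.row_space (dim_col A) A"

definition Col :: "'a::field mat \<Rightarrow> 'a vec set" where
  "Col A = vec_space.col_space (dim_row A) A"

definition mat_rank :: "'a::field mat \<Rightarrow> nat" where
  "mat_rank A = vec_space.rank (dim_row A) A"

definition R_class :: "nat \<Rightarrow> nat \<Rightarrow> 'a::field mat \<Rightarrow> 'a mat set" where
  "R_class m n X = {Y \<in> carrier_mat m n. Col Y = Col X}"

definition L_class :: "nat \<Rightarrow> nat \<Rightarrow> 'a::field mat \<Rightarrow> 'a mat set" where
  "L_class m n X = {Y \<in> carrier_mat m n. Row Y = Row X}"

definition H_class :: "nat \<Rightarrow> nat \<Rightarrow> 'a::field mat \<Rightarrow> 'a mat set" where
  "H_class m n X = R_class m n X \<inter> L_class m n X"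

definition D_class :: "nat \<Rightarrow> nat \<Rightarrow> 'a::field mat \<Rightarrow> 'a mat set" where
  "D_class m n X = {Y \<in> carrier_mat m n. mat_rank Y = mat_rank X}"


section \<open>The sandwich semigroup of \<open>m \<times> n\<close> matrices\<close>

text \<open>The sandwich matrix has the transposed shape \<open>n \<times> m\<close>.\<close>

definition Jmat :: "nat \<Rightarrow> nat \<Rightarrow> nat \<Rightarrow> 'a::field mat" where
  "Jmat m n r = mat n m (\<lambda>(i, j). if i = j \<and> i < r then 1 else 0)"

definition star :: "nat \<Rightarrow> nat \<Rightarrow> nat \<Rightarrow> 'a::field mat \<Rightarrow> 'a mat \<Rightarrow> 'a mat" where
  "star m n r X Y = X * Jmat m n r * Y"

lemma star_closed:
  "X \<in> carrier_mat m n \<Longrightarrow> Y \<in> carrier_mat m n \<Longrightarrow> star m n r X Y \<in> carrier_mat m n"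
  unfolding star_def carrier_mat_def by simp

lemma star_assoc:
  assumes "X \<in> carrier_mat m n" "Y \<in> carrier_mat m n" "Z \<in> carrier_mat m n"
  shows "star m n r (star m n r X Y) Z = star m n r X (star m n r Y Z)"
proof -
  let ?J = "Jmat m n r"
  have J: "?J \<in> carrier_mat n m" by (simp add: Jmat_def)
  have XJ: "X * ?J \<in> carrier_mat m m" and YJ: "Y * ?J \<in> carrier_mat m m"
    by (rule mult_carrier_mat[OF assms(1) J], rule mult_carrier_mat[OF assms(2) J])
  have "X * ?J * Y * ?J = X * ?J * (Y * ?J)" by (rule assoc_mult_mat[OF XJ assms(2) J])
  then show ?thesis unfolding star_def using assoc_mult_mat[OF XJ YJ assms(3)] by simp
qed

definition RJ_class :: "nat \<Rightarrow> nat \<Rightarrow> nat \<Rightarrow> 'a::field mat \<Rightarrow> 'a mat set" where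
  "RJ_class m n r X = green_R (carrier_mat m n) (star m n r) `` {X}"

definition LJ_class :: "nat \<Rightarrow> nat \<Rightarrow> nat \<Rightarrow> 'a::field mat \<Rightarrow> 'a mat set" where
  "LJ_class m n r X = green_L (carrier_mat m n) (star m n r) `` {X}"

definition HJ_class :: "nat \<Rightarrow> nat \<Rightarrow> nat \<Rightarrow> 'a::field mat \<Rightarrow> 'a mat set" where
  "HJ_class m n r X = green_H (carrier_mat m n) (star m n r) `` {X}"

definition DJ_class :: "nat \<Rightarrow> nat \<Rightarrow> nat \<Rightarrow> 'a::field mat \<Rightarrow> 'a mat set" where
  "DJ_class m n r X = green_D (carrier_mat m n) (star m n r) `` {X}"

definition P1 :: "nat \<Rightarrow> nat \<Rightarrow> nat \<Rightarrow> 'a::field mat set" where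
  "P1 m n r = {X \<in> carrier_mat m n. Col (X * Jmat m n r) = Col X}"

definition P2 :: "nat \<Rightarrow> nat \<Rightarrow> nat \<Rightarrow> 'a::field mat set" where
  "P2 m n r = {X \<in> carrier_mat m n. Row (Jmat m n r * X) = Row X}"

definition P :: "nat \<Rightarrow> nat \<Rightarrow> nat \<Rightarrow> 'a::field mat set" where
  "P m n r = P1 m n r \<inter> P2 m n r"

end

theory Submission
  imports Defs "Jordan_Normal_Form.Matrix_Kernel"
begin

text \<open>
  Column inclusion is right divisibility of matrices, so \<open>X \<in> P1\<close> means \<open>X = X \<star> W\<close> for some \<open>W\<close>,
  and then \<open>Col Y \<subseteq> Col X\<close> already gives \<open>Y = X \<star> V\<close>; conversely a nontrivial \<open>R\<close>-relation
  \<open>X = Y \<star> u\<close>, \<open>Y = X \<star> v\<close> forces \<open>X = X \<star> (v \<star> u)\<close>.  Dually for rows.  For the \<open>D\<close>-classes,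
  write \<open>X = C F\<close> and \<open>Y = C' F'\<close> with the inner dimension equal to the common rank, where the
  left factors have left inverses and the right factors have right inverses; then \<open>Z = C F'\<close> has the
  column space of \<open>X\<close> and the row space of \<open>Y\<close>.
\<close>

text \<open>The side conditions compare dimensions instead of carriers, so the simplifier can
  discharge them itself and use this as a rewrite rule.\<close>

lemma assoc_mult_mat_dim:
  "dim_col A = dim_row B \<Longrightarrow> dim_col B = dim_row C \<Longrightarrow> A * B * C = A * (B * C)"
  for A B C :: "'a::semiring_0 mat"
  by (rule assoc_mult_mat[of A "dim_row A" "dim_col A" B "dim_col B" C "dim_col C"]) auto

section \<open>Column and row inclusion as divisibility of matrices\<close>

lemma Col_eq: "Col A = {A *\<^sub>v v |v. v \<in> carrier_vec (dim_col A)}"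
  unfolding Col_def
  by (subst vec_space.col_space_eq[of _ _ "dim_col A"]) (auto intro: mult_mat_vec_carrier[of _ "dim_row A" "dim_col A"])

lemma Row_eq_Col_transpose: "Row A = Col A\<^sup>T"
  unfolding Row_def Col_def by (simp add: vec_space.row_space_eq_col_space_transpose)

text \<open>A span contains another span as soon as it contains its generators. The rank
  factorization below works with this condition on individual columns.\<close>

lemma Col_subset_iff_cols:
  fixes A B :: "'a::field mat"
  assumes "A \<in> carrier_mat m n" "B \<in> carrier_mat m k"
  shows "Col A \<subseteq> Col B \<longleftrightarrow> set (cols A) \<subseteq> Col B"
proof -
  interpret vec_space "TYPE('a)" m .
  have dims: "set (cols A) \<subseteq> carrier_vec m" "set (cols B) \<subseteq> carrier_vec m"
    using assms by (auto simp: cols_def)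
  have "span (set (cols A)) \<subseteq> span (set (cols B)) \<longleftrightarrow> set (cols A) \<subseteq> span (set (cols B))"
    using in_own_span[OF dims(1)] span_is_subset[OF _ span_is_submodule[OF dims(2)]]
    by (meson subset_trans)
  then show ?thesis using assms by (simp add: Col_def col_space_def)
qed

lemma cols_subset_Col_iff:
  assumes A: "A \<in> carrier_mat m n" and B: "B \<in> carrier_mat m k"
  shows "set (cols A) \<subseteq> Col B \<longleftrightarrow> (\<exists>U\<in>carrier_mat k n. A = B * U)"
proof
  assume sub: "set (cols A) \<subseteq> Col B"
  have "\<forall>j\<in>{..<n}. \<exists>u. u \<in> carrier_vec k \<and> col A j = B *\<^sub>v u"
  proof
    fix j assume "j \<in> {..<n}"
    then have "col A j \<in> set (cols A)" using A by (auto simp: cols_def)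
    then show "\<exists>u. u \<in> carrier_vec k \<and> col A j = B *\<^sub>v u" using sub B by (auto simp: Col_eq)
  qed
  then obtain u where u: "\<And>j. j < n \<Longrightarrow> u j \<in> carrier_vec k \<and> col A j = B *\<^sub>v u j"
    unfolding Bex_def lessThan_iff[symmetric] by metis
  \<comment> \<open>Column \<open>j\<close> of the quotient holds the coefficients that express
    column \<open>j\<close> of \<open>A\<close> through the columns of \<open>B\<close>.\<close>
  let ?U = "mat_of_cols k (map u [0..<n])"
  have U: "?U \<in> carrier_mat k n" using mat_of_cols_carrier(1)[of k "map u [0..<n]"] by simp
  have "A = B * ?U"
  proof (rule mat_col_eqI)
    fix j assume "j < dim_col (B * ?U)"
    then have j: "j < n" using U by auto
    have "col ?U j = u j" using j u[OF j] by (subst col_mat_of_cols) auto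
    then show "col A j = col (B * ?U) j" using u[OF j] by (simp add: col_mult2[OF B U j])
  qed (use A B U in auto)
  then show "\<exists>U\<in>carrier_mat k n. A = B * U" using U by blast
next
  assume "\<exists>U\<in>carrier_mat k n. A = B * U"
  then obtain U where U: "U \<in> carrier_mat k n" "A = B * U" by blast
  show "set (cols A) \<subseteq> Col B"
  proof
    fix v assume "v \<in> set (cols A)"
    then obtain j where j: "j < n" "v = col A j" using A by (auto simp: cols_def)
    have "v = B *\<^sub>v col U j" using j U by (simp add: col_mult2[OF B U(1)])
    then show "v \<in> Col B" unfolding Col_eq using B U by force
  qed
qed

lemma Col_subset_iff:
  assumes A: "A \<in> carrier_mat m n" and B: "B \<in> carrier_mat m k"
  shows "Col A \<subseteq> Col B \<longleftrightarrow> (\<exists>U\<in>carrier_mat k n. A = B * U)"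
  using Col_subset_iff_cols[OF A B] cols_subset_Col_iff[OF A B] by simp

lemma Row_subset_iff:
  fixes A B :: "'a::field mat"
  assumes A: "A \<in> carrier_mat n m" and B: "B \<in> carrier_mat k m"
  shows "Row A \<subseteq> Row B \<longleftrightarrow> (\<exists>U\<in>carrier_mat n k. A = U * B)"
proof -
  have AT: "A\<^sup>T \<in> carrier_mat m n" "B\<^sup>T \<in> carrier_mat m k" using A B by auto
  have "(\<exists>U\<in>carrier_mat k n. A\<^sup>T = B\<^sup>T * U) \<longleftrightarrow> (\<exists>U\<in>carrier_mat n k. A = U * B)"
  proof safe
    fix U :: "'a mat" assume U: "U \<in> carrier_mat k n" "A\<^sup>T = B\<^sup>T * U"
    then have "A\<^sup>T\<^sup>T = U\<^sup>T * B" using transpose_mult[OF AT(2) U(1)] by simp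
    then show "\<exists>U\<in>carrier_mat n k. A = U * B" using U(1) by (auto intro!: bexI[of _ "U\<^sup>T"])
  next
    fix U :: "'a mat" assume U: "U \<in> carrier_mat n k"
    show "\<exists>V\<in>carrier_mat k n. (U * B)\<^sup>T = B\<^sup>T * V"
      using transpose_mult[OF U B] U by (auto intro!: bexI[of _ "U\<^sup>T"])
  qed
  then show ?thesis using Col_subset_iff[OF AT] by (simp add: Row_eq_Col_transpose)
qed

section \<open>Rank, injective matrices and rank factorization\<close>

lemma mat_rank_mono:
  fixes A B :: "'a::field mat"
  assumes "A \<in> carrier_mat m n" "B \<in> carrier_mat m k" "Col A \<subseteq> Col B"
  shows "mat_rank A \<le> mat_rank B"
proof -
  interpret vec_space "TYPE('a)" m .
  have sp: "span (set (cols A)) \<subseteq> span (set (cols B))"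
    using assms(3) carrier_matD[OF assms(1)] carrier_matD[OF assms(2)]
    by (simp add: Col_def col_space_def)
  have "subspace class_ring (span (set (cols A))) V" "subspace class_ring (span (set (cols B))) V"
    using assms(1,2) by (metis cols_dim carrier_matD(1) span_is_subspace module_vec_simps(3))+
  then have "rank A \<le> rank B" unfolding rank_def
    using vectorspace.subspace_dim[OF subspace_is_vs nested_subspaces[OF _ _ sp]]
      fin_dim_span_cols[OF assms(1)] fin_dim_span_cols[OF assms(2)] by simp
  then show ?thesis using assms unfolding mat_rank_def by auto
qed

text \<open>The column space of the product lies in that of \<open>A\<close>, which has only
  \<open>k\<close> columns to generate it.\<close>

lemma mat_rank_mult_le:
  fixes A B :: "'a::field mat"
  assumes "A \<in> carrier_mat m k" "B \<in> carrier_mat k n"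
  shows "mat_rank (A * B) \<le> k"
proof -
  have "mat_rank (A * B) \<le> mat_rank A"
    using assms by (intro mat_rank_mono[of _ m n _ k]) (auto simp: Col_subset_iff[of _ m n _ k])
  also have "\<dots> \<le> k" unfolding mat_rank_def using assms by (auto intro: vec_space.rank_le_nc)
  finally show ?thesis .
qed

text \<open>If there were fewer rows than columns, padding with zero rows would give a singular
  square matrix, and a kernel vector of it is a kernel vector of \<open>A\<close>.\<close>

lemma injective_mat_dim_le:
  fixes A :: "'a::field mat"
  assumes A: "A \<in> carrier_mat p q"
    and inj: "mat_kernel A \<subseteq> {0\<^sub>v q}"
  shows "q \<le> p"
proof (rule ccontr)
  assume "\<not> q \<le> p"
  then have pq: "p < q" by simp
  \<comment> \<open>Row \<open>p\<close> is the first padded row; singling it out gives the matrix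
    the shape that \<open>det_row_0\<close> expects.\<close>
  let ?B = "mat\<^sub>r q q (\<lambda>i. if i = p then 0\<^sub>v q else if i < p then row A i else 0\<^sub>v q)"
  have B: "?B \<in> carrier_mat q q" by simp
  have "det ?B = 0" by (rule det_row_0[OF pq]) (use A in auto)
  then obtain v where v: "v \<in> carrier_vec q" "v \<noteq> 0\<^sub>v q" "?B *\<^sub>v v = 0\<^sub>v q"
    using det_0_iff_vec_prod_zero_field[OF B] by blast
  have "A *\<^sub>v v = 0\<^sub>v p"
  proof (rule eq_vecI)
    fix i assume "i < dim_vec (0\<^sub>v p)"
    then have i: "i < p" by simp
    then have "row ?B i = row A i" using pq A i by simp
    then have "(?B *\<^sub>v v) $ i = row A i \<bullet> v" using pq i by simp
    then show "(A *\<^sub>v v) $ i = 0\<^sub>v p $ i" using v(3) i pq A by simp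
  qed (use A in simp)
  then have "v \<in> mat_kernel A" using mat_kernelI[OF A v(1)] by simp
  then show False using inj v(2) by blast
qed

text \<open>Each difference of corresponding columns of \<open>A\<close> and \<open>B\<close> is in
  the kernel of \<open>C\<close>, hence zero.\<close>

lemma injective_mat_left_cancel:
  fixes A B C :: "'a::field mat"
  assumes "C \<in> carrier_mat m k" "A \<in> carrier_mat k l" "B \<in> carrier_mat k l" "C * A = C * B"
    and inj: "mat_kernel C \<subseteq> {0\<^sub>v k}"
  shows "A = B"
proof (rule mat_col_eqI)
  fix j assume "j < dim_col B"
  then have j: "j < l" using assms by auto
  have "C *\<^sub>v col A j = C *\<^sub>v col B j"
    using assms(4) j by (metis assms(1-3) col_mult2)
  moreover have ca: "col A j \<in> carrier_vec k" "col B j \<in> carrier_vec k" using assms by auto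
  ultimately have "C *\<^sub>v (col A j - col B j) = 0\<^sub>v m"
    using assms(1) by (simp add: mult_minus_distrib_mat_vec)
  then have "col A j - col B j \<in> mat_kernel C" using mat_kernelI[OF assms(1)] ca by simp
  then have "col A j - col B j = 0\<^sub>v k" using inj by blast
  moreover have "col A j = (col A j - col B j) + col B j"
    using assms by (intro eq_vecI) auto
  ultimately show "col A j = col B j" using ca by simp
qed (use assms in auto)

text \<open>The columns of \<open>C\<close> are a maximal independent set of columns of
  \<open>A\<close>. They span all columns of \<open>A\<close>, which gives \<open>F\<close>; they
  are themselves columns of \<open>A\<close>, which gives \<open>G\<close>; their independence makes
  the kernel trivial.\<close>

lemma injective_rank_factorization:
  fixes A :: "'a::field mat"
  assumes A: "A \<in> carrier_mat m n"
  obtains C F G where "C \<in> carrier_mat m (mat_rank A)" "F \<in> carrier_mat (mat_rank A) n"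
    "G \<in> carrier_mat n (mat_rank A)" "A = C * F" "C = A * G"
    "mat_kernel C \<subseteq> {0\<^sub>v (mat_rank A)}"
proof -
  interpret vec_space "TYPE('a)" m .
  have "lin_indpt {}" by (simp add: lin_dep_def)
  then obtain S where S: "maximal S (\<lambda>T. T \<subseteq> set (cols A) \<and> lin_indpt T)"
    using maximal_exists_superset[of "set (cols A)" "\<lambda>T. T \<subseteq> set (cols A) \<and> lin_indpt T" "{}"]
    by auto
  then have sub: "S \<subseteq> set (cols A)" and li: "lin_indpt S" by (auto simp: maximal_def)
  have dim: "set (cols A) \<subseteq> carrier_vec m" using A cols_dim by blast
  have card: "card S = mat_rank A" using rank_card_indpt[OF A S] A by (simp add: mat_rank_def)
  \<comment> \<open>Listing the basis without repetition gives exactly rank many columns; a repeated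
    column would also produce a nonzero kernel vector.\<close>
  obtain cs where cs: "set cs = S" "distinct cs"
    using finite_distinct_list[OF finite_subset[OF sub]] by auto
  define C where "C = mat_of_cols m cs"
  have cols: "cols C = cs" unfolding C_def using cs sub dim by auto
  have C: "C \<in> carrier_mat m (mat_rank A)"
    unfolding C_def using mat_of_cols_carrier(1)[of m cs] distinct_card[OF cs(2)] cs(1) card by simp
  have "set (cols A) \<subseteq> span S"
  proof
    fix v assume v: "v \<in> set (cols A)"
    show "v \<in> span S"
    proof (rule ccontr)
      \<comment> \<open>Such a column could be added to \<open>S\<close> without losing
        independence, against maximality.\<close>
      assume nv: "v \<notin> span S"
      then have "lin_indpt (S \<union> {v})" "v \<notin> S"
        using lin_dep_iff_in_span[of S v] span_mem[of S v] li v sub dim by auto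
      then have "S \<union> {v} = S" using S v sub unfolding maximal_def by auto
      then show False using \<open>v \<notin> S\<close> by blast
    qed
  qed
  then have "set (cols A) \<subseteq> Col C" using C cols cs by (simp add: Col_def col_space_def)
  then obtain F where F: "F \<in> carrier_mat (mat_rank A) n" "A = C * F"
    using cols_subset_Col_iff[OF A C] by blast
  have "set (cols A) \<subseteq> Col A" using Col_subset_iff_cols[OF A A] by blast
  then have "set (cols C) \<subseteq> Col A" using cols cs sub by auto
  then obtain G where G: "G \<in> carrier_mat n (mat_rank A)" "C = A * G"
    using cols_subset_Col_iff[OF C A] by blast
  show thesis
  proof (rule that[OF C F(1) G(1) F(2) G(2)])
    show "mat_kernel C \<subseteq> {0\<^sub>v (mat_rank A)}"
      using lin_depI[OF C] mat_kernelD[OF C] cols cs li by auto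
  qed
qed

lemma injective_mat_left_inverse:
  fixes C :: "'a::field mat"
  assumes C: "C \<in> carrier_mat m k"
    and inj: "mat_kernel C \<subseteq> {0\<^sub>v k}"
  obtains E where "E \<in> carrier_mat k m" "E * C = 1\<^sub>m k"
proof -
  \<comment> \<open>Injectivity of \<open>C\<close> makes the left factor of \<open>C\<^sup>T\<close> square, hence invertible.\<close>
  define l where "l = mat_rank C\<^sup>T"
  have CT: "C\<^sup>T \<in> carrier_mat k m" using C by simp
  obtain D F G where D: "D \<in> carrier_mat k l" and F: "F \<in> carrier_mat l m" and G: "G \<in> carrier_mat m l"
    and DF: "C\<^sup>T = D * F" and DG: "D = C\<^sup>T * G"
    and injD: "mat_kernel D \<subseteq> {0\<^sub>v l}"
    unfolding l_def by (rule injective_rank_factorization[OF CT])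
  have "C = F\<^sup>T * D\<^sup>T" using arg_cong[OF DF, of transpose_mat] transpose_mult[OF D F] by simp
  \<comment> \<open>Through this factorization the kernel of \<open>D\<^sup>T\<close> lies in that
    of \<open>C\<close>, so \<open>D\<^sup>T\<close> is injective too and \<open>k \<le> l\<close>;
    injectivity of \<open>D\<close> gives the opposite inequality.\<close>
  then have "C *\<^sub>v v = F\<^sup>T *\<^sub>v (D\<^sup>T *\<^sub>v v)" if "v \<in> carrier_vec k" for v
    using D F that by (simp add: assoc_mult_mat_vec[of _ m l])
  moreover have DT: "D\<^sup>T \<in> carrier_mat l k" using D by simp
  moreover have zero: "F\<^sup>T *\<^sub>v 0\<^sub>v l = 0\<^sub>v m"
    using F by (intro eq_vecI) (auto intro!: scalar_prod_right_zero)
  ultimately have "v \<in> mat_kernel C" if "v \<in> mat_kernel D\<^sup>T" for v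
    using zero mat_kernelD[OF DT that] by (intro mat_kernelI[OF C]) simp_all
  then have "mat_kernel D\<^sup>T \<subseteq> mat_kernel C" by blast
  then have "k \<le> l" using injective_mat_dim_le[OF DT] inj by blast
  moreover have "l \<le> k" using injective_mat_dim_le[OF D injD] .
  ultimately have kl: "l = k" by simp
  have D': "D \<in> carrier_mat k k" using D kl by simp
  have "det D \<noteq> 0" using det_0_iff_vec_prod_zero_field[OF D'] injD kl mat_kernelI[OF D'] by blast
  then have "D \<in> Units (ring_mat TYPE('a) k ())" by (rule det_non_zero_imp_unit[OF D'])
  then obtain N where N: "N \<in> carrier_mat k k" "D * N = 1\<^sub>m k"
    by (auto simp: Units_def ring_mat_def)
  \<comment> \<open>Since \<open>C\<^sup>T * G = D\<close> and \<open>D * N\<close> is the identity,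
    \<open>G * N\<close> is a right inverse of \<open>C\<^sup>T\<close>; its transpose is the
    required left inverse.\<close>
  have GN: "G * N \<in> carrier_mat m k" using G N kl by auto
  have "C\<^sup>T * (G * N) = 1\<^sub>m k" using DG N C G kl by (simp add: assoc_mult_mat[of _ k m _ k])
  then have "(G * N)\<^sup>T * C = 1\<^sub>m k" using transpose_mult[OF CT GN] by simp
  then show thesis using GN by (intro that[of "(G * N)\<^sup>T"]) auto
qed

text \<open>The left inverse of \<open>C\<close> comes from injectivity. The right inverse of
  \<open>F\<close> is the old \<open>G\<close>: from \<open>C F G = A G = C\<close> the injective
  factor \<open>C\<close> can be cancelled.\<close>

lemma rank_factorization:
  fixes A :: "'a::field mat"
  assumes A: "A \<in> carrier_mat m n"
  obtains C F E G where "C \<in> carrier_mat m (mat_rank A)" "F \<in> carrier_mat (mat_rank A) n"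
    "E \<in> carrier_mat (mat_rank A) m" "G \<in> carrier_mat n (mat_rank A)"
    "A = C * F" "E * C = 1\<^sub>m (mat_rank A)" "F * G = 1\<^sub>m (mat_rank A)"
proof -
  define k where "k = mat_rank A"
  obtain C F G where C: "C \<in> carrier_mat m k" and F: "F \<in> carrier_mat k n" and G: "G \<in> carrier_mat n k"
    and AC: "A = C * F" and CG: "C = A * G"
    and inj: "mat_kernel C \<subseteq> {0\<^sub>v k}"
    unfolding k_def by (rule injective_rank_factorization[OF A])
  obtain E where E: "E \<in> carrier_mat k m" "E * C = 1\<^sub>m k"
    by (rule injective_mat_left_inverse[OF C inj])
  have "C * F * G = C" using AC CG by simp
  then have "C * (F * G) = C * 1\<^sub>m k" using C F G by (simp add: assoc_mult_mat_dim)
  then have "F * G = 1\<^sub>m k"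
    using injective_mat_left_cancel[OF C _ _ _ inj, of "F * G" k "1\<^sub>m k"] F G by simp
  then show thesis using that[of C F E G] C F E G AC k_def by simp
qed

lemma same_rank_imp_D_related:
  fixes X :: "'a::field mat"
  assumes X: "X \<in> carrier_mat m n" and Y: "Y \<in> carrier_mat m n" and rank: "mat_rank X = mat_rank Y"
  obtains Z where "Z \<in> carrier_mat m n" "Col Z = Col X" "Row Z = Row Y"
proof -
  define k where "k = mat_rank X"
  obtain C F E G where C: "C \<in> carrier_mat m k" "F \<in> carrier_mat k n"
    "E \<in> carrier_mat k m" "G \<in> carrier_mat n k" and XC: "X = C * F" "E * C = 1\<^sub>m k" "F * G = 1\<^sub>m k"
    unfolding k_def by (rule rank_factorization[OF X])
  obtain C' F' E' G' where C': "C' \<in> carrier_mat m k" "F' \<in> carrier_mat k n"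
    "E' \<in> carrier_mat k m" "G' \<in> carrier_mat n k" and YC: "Y = C' * F'" "E' * C' = 1\<^sub>m k" "F' * G' = 1\<^sub>m k"
    unfolding k_def rank by (rule rank_factorization[OF Y])
  \<comment> \<open>The trailing factor \<open>B\<close> lets these inverse laws fire inside
    products that are associated to the right.\<close>
  have cancel: "F * (G * B) = B" "F' * (G' * B) = B" "E * (C * B) = B" "E' * (C' * B) = B"
    if "B \<in> carrier_mat k l" for B l
    using C C' XC YC that by (simp_all add: assoc_mult_mat_dim[symmetric])
  let ?Z = "C * F'"
  have Z: "?Z \<in> carrier_mat m n" using C C' by auto
  \<comment> \<open>Each witness replaces one outer factor by another after a one-sided inverse has
    cancelled the old one, as in \<open>C F G F' = C F'\<close>.\<close>
  have "?Z = X * (G * F')" "X = ?Z * (G' * F)" "?Z = (C * E') * Y" "Y = (C' * E) * ?Z"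
    using C C' XC(1) YC(1) by (simp_all add: assoc_mult_mat_dim cancel)
  moreover have "G * F' \<in> carrier_mat n n" "G' * F \<in> carrier_mat n n"
    "C * E' \<in> carrier_mat m m" "C' * E \<in> carrier_mat m m"
    using C C' by auto
  ultimately have "Col ?Z = Col X" "Row ?Z = Row Y"
    unfolding set_eq_subset Col_subset_iff[OF Z X] Col_subset_iff[OF X Z]
      Row_subset_iff[OF Z Y] Row_subset_iff[OF Y Z] by metis+
  then show thesis using that Z by blast
qed

text \<open>Rank is defined through columns, so row inclusion is handled by factorization:
  \<open>X = U Y = (U C) F\<close> has inner dimension \<open>mat_rank Y\<close>.\<close>

lemma mat_rank_mono_Row:
  fixes X :: "'a::field mat"
  assumes X: "X \<in> carrier_mat m n" and Y: "Y \<in> carrier_mat m n" and "Row X \<subseteq> Row Y"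
  shows "mat_rank X \<le> mat_rank Y"
proof -
  obtain U where U: "U \<in> carrier_mat m m" "X = U * Y"
    using assms(3) unfolding Row_subset_iff[OF X Y] by blast
  obtain C F where C: "C \<in> carrier_mat m (mat_rank Y)" "F \<in> carrier_mat (mat_rank Y) n" "Y = C * F"
    by (rule rank_factorization[OF Y])
  have UC: "U * C \<in> carrier_mat m (mat_rank Y)" using U(1) C(1) by (rule mult_carrier_mat)
  have "X = U * C * F" using U C by (simp add: assoc_mult_mat_dim)
  then show ?thesis using mat_rank_mult_le[OF UC C(2)] by metis
qed

section \<open>The sandwich product and the sets \<open>P1\<close> and \<open>P2\<close>\<close>

lemma dim_Jmat [simp]: "dim_row (Jmat m n r) = n" "dim_col (Jmat m n r) = m"
  by (simp_all add: Jmat_def)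

lemma Jmat_carrier [simp]: "Jmat m n r \<in> carrier_mat n m"
  by (simp add: Jmat_def)

text \<open>The inclusion of \<open>Col (X J)\<close> in \<open>Col X\<close> always holds, so only
  the reverse one is a condition, and that one is divisibility by \<open>X J\<close>.\<close>

lemma P1_iff:
  fixes X :: "'a::field mat"
  assumes X: "X \<in> carrier_mat m n"
  shows "X \<in> P1 m n r \<longleftrightarrow> (\<exists>W\<in>carrier_mat m n. X = star m n r X W)"
proof -
  let ?J = "Jmat m n r :: 'a mat"
  have XJ: "X * ?J \<in> carrier_mat m m" using X Jmat_carrier by (rule mult_carrier_mat)
  have "Col (X * ?J) \<subseteq> Col X" unfolding Col_subset_iff[OF XJ X] using Jmat_carrier by blast
  then have "X \<in> P1 m n r \<longleftrightarrow> Col X \<subseteq> Col (X * ?J)" using X unfolding P1_def by blast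
  then show ?thesis unfolding Col_subset_iff[OF X XJ] star_def .
qed

lemma P2_iff:
  fixes X :: "'a::field mat"
  assumes X: "X \<in> carrier_mat m n"
  shows "X \<in> P2 m n r \<longleftrightarrow> (\<exists>W\<in>carrier_mat m n. X = star m n r W X)"
proof -
  let ?J = "Jmat m n r :: 'a mat"
  have JX: "?J * X \<in> carrier_mat n n" using Jmat_carrier X by (rule mult_carrier_mat)
  have "Row (?J * X) \<subseteq> Row X" unfolding Row_subset_iff[OF JX X] using Jmat_carrier by blast
  then have "X \<in> P2 m n r \<longleftrightarrow> Row X \<subseteq> Row (?J * X)" using X unfolding P2_def by blast
  \<comment> \<open>Row divisibility yields \<open>W (J X)\<close>, while \<open>star\<close>
    brackets as \<open>(W J) X\<close>; the two are reconciled by associativity.\<close>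
  also have "\<dots> \<longleftrightarrow> (\<exists>W\<in>carrier_mat m n. X = star m n r W X)"
    unfolding Row_subset_iff[OF X JX] star_def
    using X by (intro bex_cong refl) (simp add: assoc_mult_mat_dim)
  finally show ?thesis .
qed

lemma Col_star_subset:
  fixes X Y :: "'a::field mat"
  assumes X: "X \<in> carrier_mat m n" and Y: "Y \<in> carrier_mat m n"
  shows "Col (star m n r X Y) \<subseteq> Col X"
  unfolding Col_subset_iff[OF star_closed[OF X Y] X]
  unfolding star_def
  using X Y by (intro bexI[of _ "Jmat m n r * Y"] mult_carrier_mat[of _ n m]) (simp_all add: assoc_mult_mat_dim)

lemma Row_star_subset:
  fixes X Y :: "'a::field mat"
  assumes X: "X \<in> carrier_mat m n" and Y: "Y \<in> carrier_mat m n"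
  shows "Row (star m n r X Y) \<subseteq> Row Y"
  unfolding Row_subset_iff[OF star_closed[OF X Y] Y]
  unfolding star_def
  using X by (intro bexI[of _ "X * Jmat m n r"] mult_carrier_mat[of _ m n]) simp_all

text \<open>Substituting \<open>X = X J W\<close> into \<open>Y = X U\<close> gives
  \<open>Y = X J (W U)\<close>, so an ordinary right multiple of \<open>X\<close> becomes a sandwich
  multiple.\<close>

lemma Col_subset_P1:
  fixes X Y :: "'a::field mat"
  assumes X: "X \<in> P1 m n r" and Y: "Y \<in> carrier_mat m n" and sub: "Col Y \<subseteq> Col X"
  obtains V where "V \<in> carrier_mat m n" "Y = star m n r X V"
proof -
  have Xc: "X \<in> carrier_mat m n" using X by (simp add: P1_def)
  obtain U where U: "U \<in> carrier_mat n n" "Y = X * U"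
    using sub unfolding Col_subset_iff[OF Y Xc] by blast
  obtain W where W: "W \<in> carrier_mat m n" "X = X * Jmat m n r * W"
    using X unfolding P1_iff[OF Xc] star_def by blast
  have "Y = X * Jmat m n r * W * U" using U(2) W(2) by simp
  also have "\<dots> = X * Jmat m n r * (W * U)"
    using Xc U W(1) by (simp add: assoc_mult_mat_dim)
  finally show thesis using that[of "W * U"] U W(1) by (simp add: star_def)
qed

lemma Row_subset_P2:
  fixes X Y :: "'a::field mat"
  assumes X: "X \<in> P2 m n r" and Y: "Y \<in> carrier_mat m n" and sub: "Row Y \<subseteq> Row X"
  obtains V where "V \<in> carrier_mat m n" "Y = star m n r V X"
proof -
  have Xc: "X \<in> carrier_mat m n" using X by (simp add: P2_def)
  obtain U where U: "U \<in> carrier_mat m m" "Y = U * X"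
    using sub unfolding Row_subset_iff[OF Y Xc] by blast
  obtain W where W: "W \<in> carrier_mat m n" "X = W * Jmat m n r * X"
    using X unfolding P2_iff[OF Xc] star_def by blast
  have "Y = U * (W * Jmat m n r * X)" using U(2) W(2) by simp
  also have "\<dots> = U * W * Jmat m n r * X"
    using Xc U(1) W(1) by (simp add: assoc_mult_mat_dim)
  finally show thesis using that[of "U * W"] U W(1) by (simp add: star_def)
qed

text \<open>The equation \<open>X = X J W\<close> survives multiplication by \<open>U\<close> on the
  left. Thus \<open>P1\<close> passes along row inclusion, although it is defined by column spaces;
  this crosswise transfer drives the results on H- and D-classes.\<close>

lemma P1_Row_subset:
  fixes X Y :: "'a::field mat"
  assumes X: "X \<in> P1 m n r" and Y: "Y \<in> carrier_mat m n" and sub: "Row Y \<subseteq> Row X"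
  shows "Y \<in> P1 m n r"
proof -
  have Xc: "X \<in> carrier_mat m n" using X by (simp add: P1_def)
  obtain U where U: "U \<in> carrier_mat m m" "Y = U * X"
    using sub unfolding Row_subset_iff[OF Y Xc] by blast
  obtain W where W: "W \<in> carrier_mat m n" "X = X * Jmat m n r * W"
    using X unfolding P1_iff[OF Xc] star_def by blast
  have "Y = U * (X * Jmat m n r * W)" using U(2) W(2) by simp
  also have "\<dots> = star m n r Y W"
    using Xc U W(1) by (simp add: star_def assoc_mult_mat_dim)
  finally show ?thesis unfolding P1_iff[OF Y] using W(1) by blast
qed

lemma P2_Col_subset:
  fixes X Y :: "'a::field mat"
  assumes X: "X \<in> P2 m n r" and Y: "Y \<in> carrier_mat m n" and sub: "Col Y \<subseteq> Col X"
  shows "Y \<in> P2 m n r"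
proof -
  have Xc: "X \<in> carrier_mat m n" using X by (simp add: P2_def)
  obtain U where U: "U \<in> carrier_mat n n" "Y = X * U"
    using sub unfolding Col_subset_iff[OF Y Xc] by blast
  obtain W where W: "W \<in> carrier_mat m n" "X = W * Jmat m n r * X"
    using X unfolding P2_iff[OF Xc] star_def by blast
  have "Y = W * Jmat m n r * X * U" using U(2) W(2) by simp
  also have "\<dots> = star m n r W Y"
    using Xc U W(1) by (simp add: star_def assoc_mult_mat_dim)
  finally show ?thesis unfolding P2_iff[OF Y] using W(1) by blast
qed

section \<open>Green's classes of the sandwich semigroup\<close>

lemma RJ_class_eq:
  fixes X :: "'a::field mat"
  assumes X: "X \<in> carrier_mat m n"
  shows "RJ_class m n r X = (if X \<in> P1 m n r then R_class m n X \<inter> P1 m n r else {X})"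
proof -
  have nontrivial: "X \<in> P1 m n r \<and> Y \<in> R_class m n X \<inter> P1 m n r"
    if Y: "Y \<in> carrier_mat m n" and uv: "u \<in> carrier_mat m n" "v \<in> carrier_mat m n"
      "X = star m n r Y u" "Y = star m n r X v" for Y u v
  proof (intro conjI IntI)
    \<comment> \<open>Each of the two equations is substituted into the other, so both elements land
      in \<open>P1\<close>.\<close>
    have "X = star m n r X (star m n r v u)" "Y = star m n r Y (star m n r u v)"
      using star_assoc[OF X uv(2,1)] star_assoc[OF Y uv(1,2)] uv(3,4) by metis+
    then show "X \<in> P1 m n r" "Y \<in> P1 m n r"
      unfolding P1_iff[OF X] P1_iff[OF Y] using star_closed[OF uv(1,2)] star_closed[OF uv(2,1)] by blast+
    have "Col Y = Col X"
      using Col_star_subset[OF X uv(2), of r, folded uv(4)]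
        Col_star_subset[OF Y uv(1), of r, folded uv(3)] by blast
    then show "Y \<in> R_class m n X" using Y by (simp add: R_class_def)
  qed
  have "Y \<in> RJ_class m n r X" if XP: "X \<in> P1 m n r" and Y: "Y \<in> R_class m n X \<inter> P1 m n r" for Y
  proof -
    have Yc: "Y \<in> carrier_mat m n" and YP: "Y \<in> P1 m n r" and CY: "Col Y = Col X"
      using Y by (auto simp: R_class_def)
    obtain v where "v \<in> carrier_mat m n" "Y = star m n r X v"
      by (rule Col_subset_P1[OF XP Yc]) (simp add: CY)
    moreover obtain u where "u \<in> carrier_mat m n" "X = star m n r Y u"
      by (rule Col_subset_P1[OF YP X]) (simp add: CY)
    ultimately show ?thesis unfolding RJ_class_def green_R_def using X Yc by blast
  qed
  moreover have "X \<in> RJ_class m n r X" using X by (simp add: RJ_class_def green_R_def)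
  \<comment> \<open>Outside \<open>P1\<close> only the disjunct from the adjoined identity remains,
    which leaves the singleton.\<close>
  moreover have "Y = X \<or> X \<in> P1 m n r \<and> Y \<in> R_class m n X \<inter> P1 m n r" if "Y \<in> RJ_class m n r X" for Y
  proof -
    have Y: "Y \<in> carrier_mat m n" and "X = Y \<or> (\<exists>u\<in>carrier_mat m n. \<exists>v\<in>carrier_mat m n.
        X = star m n r Y u \<and> Y = star m n r X v)"
      using that by (simp_all add: RJ_class_def green_R_def)
    then show ?thesis using nontrivial[OF Y] by blast
  qed
  moreover have "X \<in> R_class m n X" using X by (simp add: R_class_def)
  ultimately show ?thesis by auto
qed

lemma LJ_class_eq:
  fixes X :: "'a::field mat"
  assumes X: "X \<in> carrier_mat m n"
  shows "LJ_class m n r X = (if X \<in> P2 m n r then L_class m n X \<inter> P2 m n r else {X})"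
proof -
  have nontrivial: "X \<in> P2 m n r \<and> Y \<in> L_class m n X \<inter> P2 m n r"
    if Y: "Y \<in> carrier_mat m n" and uv: "u \<in> carrier_mat m n" "v \<in> carrier_mat m n"
      "X = star m n r u Y" "Y = star m n r v X" for Y u v
  proof (intro conjI IntI)
    have "X = star m n r (star m n r u v) X" "Y = star m n r (star m n r v u) Y"
      using star_assoc[OF uv(1,2) X] star_assoc[OF uv(2,1) Y] uv(3,4) by metis+
    then show "X \<in> P2 m n r" "Y \<in> P2 m n r"
      unfolding P2_iff[OF X] P2_iff[OF Y] using star_closed[OF uv(1,2)] star_closed[OF uv(2,1)] by blast+
    have "Row Y = Row X"
      using Row_star_subset[OF uv(2) X, of r, folded uv(4)]
        Row_star_subset[OF uv(1) Y, of r, folded uv(3)] by blast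
    then show "Y \<in> L_class m n X" using Y by (simp add: L_class_def)
  qed
  have "Y \<in> LJ_class m n r X" if XP: "X \<in> P2 m n r" and Y: "Y \<in> L_class m n X \<inter> P2 m n r" for Y
  proof -
    have Yc: "Y \<in> carrier_mat m n" and YP: "Y \<in> P2 m n r" and CY: "Row Y = Row X"
      using Y by (auto simp: L_class_def)
    obtain v where "v \<in> carrier_mat m n" "Y = star m n r v X"
      by (rule Row_subset_P2[OF XP Yc]) (simp add: CY)
    moreover obtain u where "u \<in> carrier_mat m n" "X = star m n r u Y"
      by (rule Row_subset_P2[OF YP X]) (simp add: CY)
    ultimately show ?thesis unfolding LJ_class_def green_L_def using X Yc by blast
  qed
  moreover have "X \<in> LJ_class m n r X" using X by (simp add: LJ_class_def green_L_def)
  moreover have "Y = X \<or> X \<in> P2 m n r \<and> Y \<in> L_class m n X \<inter> P2 m n r" if "Y \<in> LJ_class m n r X" for Y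
  proof -
    have Y: "Y \<in> carrier_mat m n" and "X = Y \<or> (\<exists>u\<in>carrier_mat m n. \<exists>v\<in>carrier_mat m n.
        X = star m n r u Y \<and> Y = star m n r v X)"
      using that by (simp_all add: LJ_class_def green_L_def)
    then show ?thesis using nontrivial[OF Y] by blast
  qed
  moreover have "X \<in> L_class m n X" using X by (simp add: L_class_def)
  ultimately show ?thesis by auto
qed

lemma HJ_class_eq_Int: "HJ_class m n r X = RJ_class m n r X \<inter> LJ_class m n r X"
  by (auto simp: HJ_class_def RJ_class_def LJ_class_def green_H_def)

lemma DJ_class_eq_RL: "DJ_class m n r X = (\<Union>Z\<in>RJ_class m n r X. LJ_class m n r Z)"
  by (auto simp: DJ_class_def RJ_class_def LJ_class_def green_D_def)

text \<open>The opposite order of composition is wanted when the L-class of \<open>X\<close> is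
  trivial, since the union then collapses to the R-class.\<close>

lemma DJ_class_eq_LR: "DJ_class m n r X = (\<Union>Z\<in>LJ_class m n r X. RJ_class m n r Z)"
proof -
  have "green_D (carrier_mat m n) (star m n r) =
      green_L (carrier_mat m n) (star m n r) O green_R (carrier_mat m n) (star m n r :: 'a mat \<Rightarrow> _)"
    unfolding green_D_def by (rule green_D_commute) (rule star_closed star_assoc; assumption)+
  then show ?thesis by (auto simp: DJ_class_def RJ_class_def LJ_class_def)
qed

text \<open>No intersection with \<open>P\<close> appears because equal row spaces transfer
  \<open>P1\<close> and equal column spaces transfer \<open>P2\<close>.\<close>

lemma HJ_class_P:
  fixes X :: "'a::field mat"
  assumes "X \<in> P m n r"
  shows "HJ_class m n r X = H_class m n X"
proof -
  have X: "X \<in> carrier_mat m n" "X \<in> P1 m n r" "X \<in> P2 m n r"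
    using assms by (auto simp: P_def P1_def)
  have "Y \<in> P1 m n r" "Y \<in> P2 m n r" if "Y \<in> H_class m n X" for Y
    using that P1_Row_subset[OF X(2), of Y] P2_Col_subset[OF X(3), of Y]
    by (auto simp: H_class_def R_class_def L_class_def)
  then show ?thesis using X by (auto simp: HJ_class_eq_Int RJ_class_eq LJ_class_eq H_class_def)
qed

lemma DJ_class_P:
  fixes X :: "'a::field mat"
  assumes XP: "X \<in> P m n r"
  shows "DJ_class m n r X = D_class m n X \<inter> P m n r"
proof (intro equalityI subsetI)
  have X: "X \<in> carrier_mat m n" "X \<in> P1 m n r" "X \<in> P2 m n r"
    using XP by (auto simp: P_def P1_def)
  fix Y
  {
    assume "Y \<in> DJ_class m n r X"
    then obtain Z where Z: "Z \<in> R_class m n X" "Z \<in> P1 m n r" and YZ: "Y \<in> LJ_class m n r Z"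
      using X by (auto simp: DJ_class_eq_RL RJ_class_eq)
    have Zc: "Z \<in> carrier_mat m n" and CZ: "Col Z = Col X" using Z by (auto simp: R_class_def)
    have "Z \<in> P2 m n r" using P2_Col_subset[OF X(3) Zc] CZ by simp
    then have Y: "Y \<in> carrier_mat m n" "Row Y = Row Z" "Y \<in> P2 m n r"
      using YZ Zc by (auto simp: LJ_class_eq L_class_def)
    have "Y \<in> P1 m n r" using P1_Row_subset[OF Z(2) Y(1)] Y(2) by simp
    \<comment> \<open>The rank is carried from \<open>Y\<close> to \<open>Z\<close> by the common
      row space and from \<open>Z\<close> to \<open>X\<close> by the common column space.\<close>
    moreover have "mat_rank Y = mat_rank Z"
      using mat_rank_mono_Row[OF Y(1) Zc] mat_rank_mono_Row[OF Zc Y(1)] Y(2) by simp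
    moreover have "mat_rank Z = mat_rank X"
      using mat_rank_mono[OF X(1) Zc] mat_rank_mono[OF Zc X(1)] CZ by simp
    ultimately show "Y \<in> D_class m n X \<inter> P m n r" using Y by (simp add: D_class_def P_def)
  next
    assume "Y \<in> D_class m n X \<inter> P m n r"
    then have Y: "Y \<in> carrier_mat m n" "mat_rank X = mat_rank Y" "Y \<in> P1 m n r" "Y \<in> P2 m n r"
      by (auto simp: D_class_def P_def)
    obtain Z where Z: "Z \<in> carrier_mat m n" "Col Z = Col X" "Row Z = Row Y"
      by (rule same_rank_imp_D_related[OF X(1) Y(1,2)])
    \<comment> \<open>The intermediate matrix inherits \<open>P1\<close> from \<open>Y\<close>
      through rows and \<open>P2\<close> from \<open>X\<close> through columns.\<close>
    have ZP: "Z \<in> P1 m n r" "Z \<in> P2 m n r"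
      using P1_Row_subset[OF Y(3) Z(1)] P2_Col_subset[OF X(3) Z(1)] Z by simp_all
    have "Z \<in> RJ_class m n r X" using X Z ZP by (simp add: RJ_class_eq R_class_def)
    moreover have "Y \<in> LJ_class m n r Z" using Y Z ZP by (simp add: LJ_class_eq L_class_def)
    ultimately show "Y \<in> DJ_class m n r X" unfolding DJ_class_eq_RL by blast
  }
qed

section \<open>The rank bound for sandwich products and the final assembly\<close>

lemma Jmat_factorization:
  assumes "r \<le> min m n"
  obtains A B :: "'a::field mat" where "A \<in> carrier_mat n r" "B \<in> carrier_mat r m" "Jmat m n r = A * B"
proof -
  let ?A = "mat n r (\<lambda>(i, j). if i = j then 1 else 0) :: 'a mat"
  let ?B = "mat r m (\<lambda>(i, j). if i = j then 1 else 0) :: 'a mat"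
  have "Jmat m n r = ?A * ?B"
  proof (rule eq_matI)
    fix i j assume "i < dim_row (?A * ?B)" "j < dim_col (?A * ?B)"
    then have ij: "i < n" "j < m" by auto
    then have "(?A * ?B) $$ (i, j) = (\<Sum>k = 0..<r. (if i = k then 1 else 0) * (if k = j then 1 else 0))"
      by (simp add: scalar_prod_def)
    \<comment> \<open>Merging the two indicators into one in \<open>k\<close> prepares
      \<open>sum.delta\<close>, whose range condition supplies \<open>i < r\<close>.\<close>
    also have "\<dots> = (\<Sum>k = 0..<r. if k = i then if i = j then 1 else 0 else 0)"
      by (intro sum.cong) auto
    also have "\<dots> = (if i = j \<and> i < r then 1 else 0)" by (simp add: sum.delta)
    finally show "Jmat m n r $$ (i, j) = (?A * ?B) $$ (i, j)" using ij by (simp add: Jmat_def)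
  qed (auto simp: Jmat_def)
  then show thesis using that[of ?A ?B] by simp
qed

text \<open>Factoring \<open>J\<close> through dimension \<open>r\<close> makes \<open>X J Y\<close>
  a product with inner dimension \<open>r\<close>.\<close>

lemma mat_rank_star_le:
  fixes X Y :: "'a::field mat"
  assumes X: "X \<in> carrier_mat m n" and Y: "Y \<in> carrier_mat m n" and r: "r \<le> min m n"
  shows "mat_rank (star m n r X Y) \<le> r"
proof -
  obtain A B :: "'a mat" where AB: "A \<in> carrier_mat n r" "B \<in> carrier_mat r m" "Jmat m n r = A * B"
    by (rule Jmat_factorization[OF r])
  have "star m n r X Y = (X * A) * (B * Y)"
    using AB X Y by (simp add: star_def assoc_mult_mat_dim)
  then show ?thesis using mat_rank_mult_le[of "X * A" m r "B * Y" n] AB X Y by simp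
qed

theorem theorem4p5:
  fixes m n r :: nat and X :: "'a::field mat"
  assumes "1 \<le> m" and "1 \<le> n" and "r \<le> min m n"
    and "X \<in> carrier_mat m n"
  shows
    "(X \<in> P1 m n r \<longrightarrow> RJ_class m n r X = R_class m n X \<inter> P1 m n r) \<and>
     (X \<in> carrier_mat m n - P1 m n r \<longrightarrow> RJ_class m n r X = {X}) \<and>

     (X \<in> P2 m n r \<longrightarrow> LJ_class m n r X = L_class m n X \<inter> P2 m n r) \<and>
     (X \<in> carrier_mat m n - P2 m n r \<longrightarrow> LJ_class m n r X = {X}) \<and>

     (X \<in> P m n r \<longrightarrow> HJ_class m n r X = H_class m n X) \<and>
     (X \<in> carrier_mat m n - P m n r \<longrightarrow> HJ_class m n r X = {X}) \<and>

     (X \<in> P m n r \<longrightarrow> DJ_class m n r X = D_class m n X \<inter> P m n r) \<and>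
     (X \<in> P2 m n r - P1 m n r \<longrightarrow> DJ_class m n r X = LJ_class m n r X) \<and>
     (X \<in> P1 m n r - P2 m n r \<longrightarrow> DJ_class m n r X = RJ_class m n r X) \<and>
     (X \<in> carrier_mat m n - (P1 m n r \<union> P2 m n r) \<longrightarrow> DJ_class m n r X = {X}) \<and>

     (mat_rank X > r \<longrightarrow>
        RJ_class m n r X = {X} \<and> LJ_class m n r X = {X} \<and>
        HJ_class m n r X = {X} \<and> DJ_class m n r X = {X}) \<and>

     (X \<in> carrier_mat m n - P m n r \<longrightarrow>
        HJ_class m n r X = {X} \<and> \<not> is_group_under (HJ_class m n r X) (star m n r))"
proof -
  note X = assms(4)
  note RJ = RJ_class_eq[OF X, of r] and LJ = LJ_class_eq[OF X, of r]
  have self: "X \<in> R_class m n X" "X \<in> L_class m n X"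
    using X by (simp_all add: R_class_def L_class_def)
  have HJ: "HJ_class m n r X = {X}" if "X \<notin> P m n r"
    using that self by (auto simp: HJ_class_eq_Int RJ LJ P_def)
  \<comment> \<open>Here the R-class of \<open>X\<close> is a singleton, so the union over it has
    one term; \<open>D2\<close> is dual.\<close>
  have D1: "DJ_class m n r X = LJ_class m n r X" if "X \<notin> P1 m n r"
    using that by (simp add: DJ_class_eq_RL RJ)
  have D2: "DJ_class m n r X = RJ_class m n r X" if "X \<notin> P2 m n r"
    using that by (simp add: DJ_class_eq_LR LJ)
  \<comment> \<open>Membership in \<open>P1\<close> or \<open>P2\<close> would make \<open>X\<close>
    a sandwich product, whose rank is at most \<open>r\<close>.\<close>
  have large: "X \<notin> P1 m n r" "X \<notin> P2 m n r" if "mat_rank X > r"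
  proof -
    have "X \<noteq> star m n r A B" if "A \<in> carrier_mat m n" "B \<in> carrier_mat m n" for A B
      using mat_rank_star_le[OF that assms(3)] \<open>mat_rank X > r\<close> by auto
    then show "X \<notin> P1 m n r" "X \<notin> P2 m n r"
      unfolding P1_iff[OF X] P2_iff[OF X] using X by blast+
  qed
  have no_group: "\<not> is_group_under {X} (star m n r)" if "X \<notin> P m n r"
  proof
    assume "is_group_under {X} (star m n r)"
    then obtain e where "group \<lparr>carrier = {X}, mult = star m n r, one = e\<rparr>"
      by (auto simp: is_group_under_def)
    \<comment> \<open>Closure alone makes \<open>X\<close> idempotent, and then \<open>X\<close>
      itself is the witness for both \<open>P1\<close> and \<open>P2\<close>.\<close>
    then have "X = star m n r X X"
      using group.is_monoid monoid.m_closed[of "\<lparr>carrier = {X}, mult = star m n r, one = e\<rparr>" X X]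
      by fastforce
    then have "X \<in> P m n r" unfolding P_def Int_iff P1_iff[OF X] P2_iff[OF X] using X by blast
    then show False using that by blast
  qed
  show ?thesis
    using RJ LJ HJ D1 D2 large no_group HJ_class_P[of X m n r] DJ_class_P[of X m n r]
    by (auto simp: P_def)
qed

end
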